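(* Let $\Omega_i=\mathbb{R}^{m_i}$, and let $\gamma^{1*}:\Omega_2\times\Omega_3\to\Omega_1$ be the announced optimal affine reverse Stackelberg strategy of the leader. Suppose that $\bar W^{3d}$ is convex and locally strictly convex at the point $(u^{2d},u^{3d})$ and that $\bar J_3$ is Fréchet differentiable at $(u^{2d},u^{3d})$. If $\nabla_{u^2}\bar J_3(u^{2d},u^{3d})\ne 0$, then there exists an (affine) optimal strategy $\gamma^{2*}:\Omega_3\to\Omega_2$ of the middle level player, with $\gamma^{2*}(u^{3d})=u^{2d}$, such that $$u^{3d}=\operatorname*{argmin}_{u^3\in\Omega_3}J_3\big(\gamma^{1*}(\gamma^{2*}(u^3),u^3),\gamma^{2*}(u^3),u^3\big),$$ i.e. $u^{3d}$ is the unique minimizer.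
   Context: Trilevel static game: the leader, the middle level player and the follower choose $u^1\in\Omega_1$, $u^2\in\Omega_2$, $u^3\in\Omega_3$ respectively, where $\Omega_i=\mathbb{R}^{m_i}$, $m_i\ge 1$, and minimize cost functions $J_1,J_2,J_3:\Omega_1\times\Omega_2\times\Omega_3\to\mathbb{R}$ respectively. $J_1$ is assumed to have a unique global minimizer $(u^{1d},u^{2d},u^{3d})$, called the desired equilibrium. An optimal affine reverse Stackelberg strategy of the leader is an affine map $\gamma^{1*}:\Omega_2\times\Omega_3\to\Omega_1$ with $\gamma^{1*}(u^{2d},u^{3d})=u^{1d}$ such that $(u^{2d},u^{3d})$ is the unique minimizer of $(u^2,u^3)\mapsto J_2(\gamma^{1*}(u^2,u^3),u^2,u^3)$ over $\Omega_2\times\Omega_3$. For the fixed $\gamma^{1*}$, $\bar J_3(u^2,u^3)=J_3(\gamma^{1*}(u^2,u^3),u^2,u^3)$ and $\bar W^{3d}=\{(u^2,u^3)\in\Omega_2\times\Omega_3:\bar J_3(u^2,u^3)\le\bar J_3(u^{2d},u^{3d})\}$. Admissible strategies of the middle level player are the affine maps $\gamma^2:\Omega_3\to\Omega_2$ with $\gamma^2(u^{3d})=u^{2d}$. A set $W$ is locally strictly convex at a point $x\in W$ if $x$ is a boundary point of $W$ and there is a neighbourhood $U$ of $x$ such that for every $y\in W\cap U$, $y\ne x$, the open segment between $x$ and $y$ lies in the interior of $W$. *)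

theory Defs
  imports "HOL-Analysis.Analysis"
begin

definition affine_map :: "('a::real_vector \<Rightarrow> 'b::real_vector) \<Rightarrow> bool" where
  "affine_map f \<longleftrightarrow> (\<exists>L c. linear L \<and> f = (\<lambda>x. L x + c))"

definition unique_minimizer :: "('a \<Rightarrow> real) \<Rightarrow> 'a \<Rightarrow> bool" where
  "unique_minimizer f x \<longleftrightarrow> (\<forall>y. is_arg_min f (\<lambda>_. True) y \<longleftrightarrow> y = x)"

text \<open>Meaningful only where \<open>f\<close> is differentiable at \<open>x\<close>.\<close>

definition gradient :: "('a::euclidean_space \<Rightarrow> real) \<Rightarrow> 'a \<Rightarrow> 'a" where
  "gradient f x = (THE D. GDERIV f x :> D)"

definition locally_strictly_convex_at :: "'a::real_normed_vector set \<Rightarrow> 'a \<Rightarrow> bool" where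
  "locally_strictly_convex_at W x \<longleftrightarrow>
     x \<in> W \<and> x \<in> frontier W \<and>
     (\<exists>U. open U \<and> x \<in> U \<and>
        (\<forall>y \<in> W \<inter> U. y \<noteq> x \<longrightarrow> open_segment x y \<subseteq> interior W))"

text \<open>The cost \<open>J\<close> as a function of the decisions of the lower two players, once the leader
  has announced \<open>\<gamma>1\<close>.\<close>

definition reduced_cost :: "('a \<times> 'b \<times> 'c \<Rightarrow> real) \<Rightarrow> ('b \<times> 'c \<Rightarrow> 'a) \<Rightarrow> 'b \<times> 'c \<Rightarrow> real" where
  "reduced_cost J \<gamma>1 = (\<lambda>(u2, u3). J (\<gamma>1 (u2, u3), u2, u3))"

definition optimal_affine_leader_strategy ::
  "('a::real_vector \<times> 'b::real_vector \<times> 'c::real_vector \<Rightarrow> real) \<Rightarrow> 'a \<Rightarrow> 'b \<Rightarrow> 'c \<Rightarrow>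
   ('b \<times> 'c \<Rightarrow> 'a) \<Rightarrow> bool" where
  "optimal_affine_leader_strategy J2 u1d u2d u3d \<gamma>1 \<longleftrightarrow>
     affine_map \<gamma>1 \<and> \<gamma>1 (u2d, u3d) = u1d \<and>
     unique_minimizer (reduced_cost J2 \<gamma>1) (u2d, u3d)"

definition level_set_at ::
  "('a \<times> 'b \<times> 'c \<Rightarrow> real) \<Rightarrow> ('b \<times> 'c \<Rightarrow> 'a) \<Rightarrow> 'b \<times> 'c \<Rightarrow> ('b \<times> 'c) set" where
  "level_set_at J3 \<gamma>1 d = {w. reduced_cost J3 \<gamma>1 w \<le> reduced_cost J3 \<gamma>1 d}"

text \<open>Optimality of the middle level player's strategy is, as for the leader, the property of
  inducing the desired equilibrium as the unique response of the player below. The middle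
  player's own cost \<open>J2\<close> enters only through \<open>\<gamma>1\<close>, whose optimality makes \<open>(u2d, u3d)\<close> the
  best outcome for that player.\<close>

definition optimal_affine_middle_strategy ::
  "('a::real_vector \<times> 'b::real_vector \<times> 'c::real_vector \<Rightarrow> real) \<Rightarrow> ('b \<times> 'c \<Rightarrow> 'a) \<Rightarrow>
   'b \<Rightarrow> 'c \<Rightarrow> ('c \<Rightarrow> 'b) \<Rightarrow> bool" where
  "optimal_affine_middle_strategy J3 \<gamma>1 u2d u3d \<gamma>2 \<longleftrightarrow>
     affine_map \<gamma>2 \<and> \<gamma>2 u3d = u2d \<and>
     unique_minimizer (\<lambda>u3. J3 (\<gamma>1 (\<gamma>2 u3, u3), \<gamma>2 u3, u3)) u3d"

end

theory Submission
  imports Defs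
begin

text \<open>The first-order condition bounds the convex sublevel set \<open>W\<close> by the hyperplane orthogonal to
  the gradient of the reduced cost at the desired point, and strict convexity makes \<open>W\<close> touch it only there. Since the
  \<open>u2\<close>-part of the gradient is nonzero, the hyperplane contains the graph of an affine map
  \<open>u3 \<mapsto> u2\<close>, and along this graph the reduced cost strictly exceeds its value at the desired point.\<close>

text \<open>A positive derivative towards \<open>y\<close> would push \<open>f\<close> above
  \<open>f d\<close> just after leaving \<open>d\<close>, while convexity keeps the whole segment
  from \<open>d\<close> to \<open>y\<close> in the sublevel set.\<close>

lemma has_derivative_convex_sublevel_nonpos:
  fixes f :: "'a::real_normed_vector \<Rightarrow> real"
  assumes f': "(f has_derivative f') (at d)"
    and W: "convex {w. f w \<le> f d}" and y: "f y \<le> f d"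
  shows "f' (y - d) \<le> 0"
proof (rule ccontr)
  assume pos: "\<not> f' (y - d) \<le> 0"
  interpret f': bounded_linear f' using f' by (rule has_derivative_bounded_linear)
  have "((\<lambda>t::real. f (d + t *\<^sub>R (y - d))) has_derivative (\<lambda>t. f' (t *\<^sub>R (y - d)))) (at 0)"
    by (rule has_derivative_compose[where g = f and f = "\<lambda>t. d + t *\<^sub>R (y - d)"])
       (use f' in \<open>auto intro!: derivative_eq_intros\<close>)
  then have "((\<lambda>t::real. f (d + t *\<^sub>R (y - d))) has_real_derivative f' (y - d)) (at 0)"
    by (simp add: has_field_derivative_def f'.scaleR mult_commute_abs)
  from DERIV_pos_inc_right[OF this] pos
  obtain e where e: "e > 0" "\<And>h. 0 < h \<Longrightarrow> h < e \<Longrightarrow> f d < f (d + h *\<^sub>R (y - d))"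
    by auto
  \<comment> \<open>Below \<open>e\<close> the value has risen above \<open>f d\<close>; the cap at
    1 keeps the point on the segment.\<close>
  define h where "h = min (e / 2) 1"
  have h: "0 < h" "h < e" "h \<le> 1" using e(1) by (auto simp: h_def)
  have "(1 - h) *\<^sub>R d + h *\<^sub>R y \<in> {w. f w \<le> f d}"
    by (rule convexD_alt[OF W]) (use h y in auto)
  moreover have "(1 - h) *\<^sub>R d + h *\<^sub>R y = d + h *\<^sub>R (y - d)" by (simp add: algebra_simps)
  ultimately show False using e(2)[OF h(1,2)] by simp
qed

text \<open>An interior point leaves room for a small shift along \<open>v\<close> that raises
  \<open>f'\<close>. The shifted point still obeys the nonpositive bound, so there was slack before
  the shift.\<close>

lemma has_derivative_convex_sublevel_interior_neg:
  fixes f :: "'a::real_normed_vector \<Rightarrow> real"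
  assumes f': "(f has_derivative f') (at d)" and v: "f' v \<noteq> 0"
    and W: "convex {w. f w \<le> f d}" and p: "p \<in> interior {w. f w \<le> f d}"
  shows "f' (p - d) < 0"
proof -
  interpret f': bounded_linear f' using f' by (rule has_derivative_bounded_linear)
  have "v \<noteq> 0" using v by (auto simp: f'.zero)
  obtain e where e: "e > 0" "ball p e \<subseteq> {w. f w \<le> f d}"
    using p by (auto simp: mem_interior)
  \<comment> \<open>The sign makes \<open>s * f' v\<close> positive, and the shift has length
    \<open>e / 2\<close>, within the ball.\<close>
  define s where "s = sgn (f' v) * (e / (2 * norm v))"
  have "norm (s *\<^sub>R v) < e"
    using e(1) \<open>v \<noteq> 0\<close> v by (simp add: s_def abs_mult abs_sgn_eq)
  then have "p + s *\<^sub>R v \<in> ball p e" by (simp add: dist_norm)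
  then have "f' (p + s *\<^sub>R v - d) \<le> 0"
    using has_derivative_convex_sublevel_nonpos[OF f' W] e(2) by blast
  then have "f' (p - d) + s * f' v \<le> 0"
    by (simp add: f'.add f'.diff f'.scaleR algebra_simps)
  moreover have "s * f' v > 0"
  proof -
    have "s * f' v = \<bar>f' v\<bar> * (e / (2 * norm v))" by (simp add: s_def abs_sgn)
    also have "\<dots> > 0" using e(1) \<open>v \<noteq> 0\<close> v by (intro mult_pos_pos divide_pos_pos) auto
    finally show ?thesis .
  qed
  ultimately show ?thesis by linarith
qed

text \<open>Makes the local hypothesis usable for a distant \<open>w\<close>: by convexity,
  \<open>w\<close> may be replaced by a point of \<open>W\<close> on the same ray close to
  \<open>d\<close>.\<close>

lemma locally_strictly_convex_at_has_interior_segment_point: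
  assumes W: "convex W" and lsc: "locally_strictly_convex_at W d"
    and w: "w \<in> W" "w \<noteq> d"
  obtains t where "0 < t" "d + t *\<^sub>R (w - d) \<in> interior W"
proof -
  obtain U where U: "open U" "d \<in> U"
      "\<And>y. y \<in> W \<inter> U \<Longrightarrow> y \<noteq> d \<Longrightarrow> open_segment d y \<subseteq> interior W" and d: "d \<in> W"
    using lsc by (auto simp: locally_strictly_convex_at_def)
  obtain e where e: "e > 0" "ball d e \<subseteq> U" using U(1,2) openE by blast
  have n: "norm (w - d) > 0" using w(2) by simp
  define t where "t = min 1 (e / (2 * norm (w - d)))"
  have t: "0 < t" "t \<le> 1" using e(1) n by (auto simp: t_def)
  have "t * norm (w - d) \<le> e / (2 * norm (w - d)) * norm (w - d)"
    using n by (intro mult_right_mono) (auto simp: t_def)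
  also have "\<dots> < e" using e(1) n by simp
  finally have "t * norm (w - d) < e" .
  define y where "y = d + t *\<^sub>R (w - d)"
  have "y \<in> U" using \<open>t * norm (w - d) < e\<close> t e(2) by (auto simp: y_def dist_norm)
  moreover have "y \<in> W"
    using convexD_alt[OF W d w(1), of t] t by (simp add: y_def algebra_simps)
  moreover have "y \<noteq> d" using t w(2) by (simp add: y_def)
  ultimately have "open_segment d y \<subseteq> interior W" using U(3) by blast
  \<comment> \<open>Only the open segment is known to be interior, so the midpoint of
    \<open>d\<close> and \<open>y\<close> serves as witness.\<close>
  moreover have "d + (t / 2) *\<^sub>R (w - d) = (1 - 1 / 2) *\<^sub>R d + (1 / 2) *\<^sub>R y"
    by (simp add: y_def scaleR_right_distrib flip: scaleR_left_distrib)
  then have "d + (t / 2) *\<^sub>R (w - d) \<in> open_segment d y"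
    using \<open>y \<noteq> d\<close> unfolding in_segment by (intro conjI exI[of _ "1 / 2"]) auto
  ultimately show thesis using t(1) by (intro that[of "t / 2"]) auto
qed

text \<open>Otherwise some interior point would lie on the ray from \<open>d\<close> through
  \<open>w\<close>, where \<open>f'\<close> must be negative, yet by linearity it vanishes on the
  whole ray.\<close>

lemma less_on_tangent_hyperplane:
  fixes f :: "'a::real_normed_vector \<Rightarrow> real"
  assumes f': "(f has_derivative f') (at d)" and v: "f' v \<noteq> 0"
    and W: "convex {w. f w \<le> f d}"
    and lsc: "locally_strictly_convex_at {w. f w \<le> f d} d"
    and w: "f' (w - d) = 0" "w \<noteq> d"
  shows "f d < f w"
proof (rule ccontr)
  assume "\<not> f d < f w"
  then have "w \<in> {w. f w \<le> f d}" by simp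
  then obtain t where "d + t *\<^sub>R (w - d) \<in> interior {w. f w \<le> f d}"
    using locally_strictly_convex_at_has_interior_segment_point[OF W lsc] w(2) by blast
  from has_derivative_convex_sublevel_interior_neg[OF f' v W this]
  have "f' (t *\<^sub>R (w - d)) < 0" by simp
  moreover have "f' (t *\<^sub>R (w - d)) = 0"
    using w(1) linear_scale[OF has_derivative_linear[OF f']] by simp
  ultimately show False by simp
qed

lemma gradient_eqI:
  assumes "GDERIV f x :> D"
  shows "gradient f x = D"
  unfolding gradient_def
proof (rule the_equality, rule assms)
  fix D' assume "GDERIV f x :> D'"
  then have "(\<lambda>h. h \<bullet> D') = (\<lambda>h. h \<bullet> D)"
    using assms by (intro has_derivative_unique[of f _ x]) (auto simp: gderiv_def)
  then show "D' = D" by (metis vector_eq_ldot inner_commute)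
qed

text \<open>The partial gradient represents the restriction of \<open>f'\<close> to the first
  factor, so it would be 0 if that restriction vanished.\<close>

lemma gradient_fst_nonzeroE:
  fixes f :: "'b::euclidean_space \<times> 'c::real_normed_vector \<Rightarrow> real"
  assumes f': "(f has_derivative f') (at (a, b))"
    and "gradient (\<lambda>x. f (x, b)) a \<noteq> 0"
  obtains v where "f' (v, 0) \<noteq> 0"
proof (rule ccontr)
  assume "\<not> thesis"
  with that have z: "f' (v, 0) = 0" for v by blast
  have "((\<lambda>x. f (x, b)) has_derivative (\<lambda>h. f' (h, 0))) (at a)"
    by (rule has_derivative_compose[where g = f and f = "\<lambda>x. (x, b)"])
       (use f' in \<open>auto intro!: derivative_eq_intros\<close>)
  then have "GDERIV (\<lambda>x. f (x, b)) a :> 0" by (simp add: gderiv_def z)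
  then show False using assms(2) gradient_eqI by blast
qed

theorem theorem3p10:
  fixes J1 J2 J3 :: "(real^'m1) \<times> (real^'m2) \<times> (real^'m3) \<Rightarrow> real"
    and u1d :: "real^'m1" and u2d :: "real^'m2" and u3d :: "real^'m3"
    and \<gamma>1 :: "(real^'m2) \<times> (real^'m3) \<Rightarrow> real^'m1"
  assumes "unique_minimizer J1 (u1d, u2d, u3d)"
    and "optimal_affine_leader_strategy J2 u1d u2d u3d \<gamma>1"
    and "convex (level_set_at J3 \<gamma>1 (u2d, u3d))"
    and "locally_strictly_convex_at (level_set_at J3 \<gamma>1 (u2d, u3d)) (u2d, u3d)"
    and "reduced_cost J3 \<gamma>1 differentiable (at (u2d, u3d))"
    and "gradient (\<lambda>u2. reduced_cost J3 \<gamma>1 (u2, u3d)) u2d \<noteq> 0"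
  shows "\<exists>\<gamma>2. optimal_affine_middle_strategy J3 \<gamma>1 u2d u3d \<gamma>2"
proof -
  define f where "f = reduced_cost J3 \<gamma>1"
  obtain f' where f': "(f has_derivative f') (at (u2d, u3d))"
    using assms(5) by (auto simp: f_def differentiable_def)
  interpret f': bounded_linear f' using f' by (rule has_derivative_bounded_linear)
  obtain v where v: "f' (v, 0) \<noteq> 0"
    using gradient_fst_nonzeroE[OF f'] assms(6) by (auto simp: f_def)
  \<comment> \<open>The multiple of \<open>v\<close> is the one that cancels
    \<open>f' (0, h)\<close>, giving \<open>f' (L h, h) = 0\<close>; the constant in
    \<open>\<gamma>2\<close> then moves the graph through the desired point.\<close>
  define L where "L h = - (f' (0, h) / f' (v, 0)) *\<^sub>R v" for h
  define \<gamma>2 where "\<gamma>2 u = L u + (u2d - L u3d)" for u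
  have \<gamma>2_u3d: "\<gamma>2 u3d = u2d" by (simp add: \<gamma>2_def)
  have "linear L"
  proof (rule linearI)
    show "L (x + y) = L x + L y" for x y
      using f'.add[of "(0, x)" "(0, y)"]
      by (simp add: L_def add_divide_distrib scaleR_left_distrib scaleR_left_diff_distrib)
    show "L (r *\<^sub>R x) = r *\<^sub>R L x" for r x
      using f'.scaleR[of r "(0, x)"] by (simp add: L_def)
  qed
  have tangent: "f' ((\<gamma>2 u, u) - (u2d, u3d)) = 0" for u
  proof -
    have "(\<gamma>2 u, u) - (u2d, u3d) = (L (u - u3d), u - u3d)"
      by (simp add: \<gamma>2_def linear_diff[OF \<open>linear L\<close>])
    also have "\<dots> = (0, u - u3d) - (f' (0, u - u3d) / f' (v, 0)) *\<^sub>R (v, 0)"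
      by (simp add: L_def)
    also have "f' \<dots> = 0" using v by (simp only: f'.diff f'.scaleR) simp
    finally show ?thesis .
  qed
  have strict: "f (u2d, u3d) < f (\<gamma>2 u, u)" if "u \<noteq> u3d" for u
    by (rule less_on_tangent_hyperplane[OF f' v])
       (use assms(3,4) tangent that in \<open>auto simp: f_def level_set_at_def\<close>)
  have "unique_minimizer (\<lambda>u. f (\<gamma>2 u, u)) u3d"
    unfolding unique_minimizer_def is_arg_min_linorder
    using strict \<gamma>2_u3d by (metis less_le order_refl not_less)
  moreover have "affine_map \<gamma>2"
    unfolding affine_map_def using \<open>linear L\<close> \<gamma>2_def by blast
  ultimately have "optimal_affine_middle_strategy J3 \<gamma>1 u2d u3d \<gamma>2"
    by (simp add: optimal_affine_middle_strategy_def f_def reduced_cost_def \<gamma>2_u3d)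
  then show ?thesis by blast
qed

end
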